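(* Let $\rho\in\mathbb C$ with $\operatorname{Re}\rho>0$, $m\in\mathbb N$, $v\in\mathbb C$, $\omega>0$, and let $f:(0,\infty)\to\mathbb C$ be continuous or piecewise continuous. Let $\alpha>0$ and suppose that the involved integrals converge absolutely, i.e. the integral defining $\mathcal M_{\rho,m}[f(t)](u,v,\omega)$ converges absolutely for $\operatorname{Re}u=\alpha$, and $u\mapsto\mathcal M_{\rho,m}[f(t)](u,v,\omega)$ is absolutely integrable along the line $\operatorname{Re}u=\alpha$. Then, for every $x>0$ at which $f$ is continuous, $$f(x)=\Big(\frac{x^m}{\omega^m}+\omega^m\Big)^{\rho}e^{\omega v/x}\,\mathcal L^{-1}\big[\mathcal M_{\rho,m}[f(t)](u,v,\omega)\big]\Big(\frac x\omega\Big),$$ where $\mathcal L^{-1}$ is the inverse Laplace transform with respect to $u$ (with $v,\omega$ as parameters), that is, $$f(x)=\Big(\frac{x^m}{\omega^m}+\omega^m\Big)^{\rho}e^{\omega v/x}\,\frac1{2\pi i}\int_{\alpha-i\infty}^{\alpha+i\infty}e^{ux/\omega}\,\mathcal M_{\rho,m}[f(t)](u,v,\omega)\,du.$$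
   Context: $\mathbb N=\{1,2,\dots\}$. For $\rho\in\mathbb C$, $m\in\mathbb N$, $u,v\in\mathbb C$, $\omega>0$ and a function $f$ on $(0,\infty)$, $$\mathcal M_{\rho,m}[f(x)](u,v,\omega)=\int_0^\infty \frac{e^{-ux-v/x}}{(x^m+\omega^m)^\rho}f(\omega x)\,dx,$$ where $x$ (or $t$) inside the brackets is a dummy variable. The inverse Laplace transform is $\mathcal L^{-1}[F(s)](x)=\frac1{2\pi i}\int_{\alpha-i\infty}^{\alpha+i\infty}e^{sx}F(s)\,ds$, $\alpha>0$. Piecewise continuous on $(0,\infty)$ means: finitely many discontinuities on each compact subinterval of $(0,\infty)$. *)

theory Defs
  imports "HOL-Analysis.Analysis"
begin

text \<open>
  Functions on \<open>(0, \<infinity>)\<close> are total functions on the reals whose values outside \<open>(0, \<infinity>)\<close> are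
  irrelevant. As \<open>(0, \<infinity>)\<close> is open, continuity at a point of it is plain \<^const>\<open>isCont\<close>.
\<close>

definition piecewise_continuous_pos :: "(real \<Rightarrow> complex) \<Rightarrow> bool" where
  "piecewise_continuous_pos f \<longleftrightarrow>
     (\<forall>a b. 0 < a \<longrightarrow> a \<le> b \<longrightarrow> finite {x \<in> {a..b}. \<not> isCont f x})"

text \<open>
  The base of the complex power is a positive real, so \<open>powr\<close> is the usual principal power.
\<close>

definition M_integrand ::
  "complex \<Rightarrow> nat \<Rightarrow> (real \<Rightarrow> complex) \<Rightarrow> complex \<Rightarrow> complex \<Rightarrow> real \<Rightarrow> real \<Rightarrow> complex" where
  "M_integrand \<rho> m f u v \<omega> x =
     exp (- u * of_real x - v / of_real x) / (of_real (x ^ m + \<omega> ^ m) powr \<rho>) * f (\<omega> * x)"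

definition M_transform ::
  "complex \<Rightarrow> nat \<Rightarrow> (real \<Rightarrow> complex) \<Rightarrow> complex \<Rightarrow> complex \<Rightarrow> real \<Rightarrow> complex" where
  "M_transform \<rho> m f u v \<omega> = (LINT x:{0<..}|lborel. M_integrand \<rho> m f u v \<omega> x)"

definition M_abs_convergent ::
  "complex \<Rightarrow> nat \<Rightarrow> (real \<Rightarrow> complex) \<Rightarrow> complex \<Rightarrow> complex \<Rightarrow> real \<Rightarrow> bool" where
  "M_abs_convergent \<rho> m f u v \<omega> \<longleftrightarrow> set_integrable lborel {0<..} (M_integrand \<rho> m f u v \<omega>)"

text \<open>
  The upward line \<open>Re s = \<alpha>\<close> is parametrised by \<open>s = \<alpha> + \<i> t\<close>, so that \<open>ds = \<i> dt\<close>. The integral is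
  a Lebesgue integral, meaningful when \<open>h\<close> is absolutely integrable along the line.
\<close>

definition vertical_line_integral :: "real \<Rightarrow> (complex \<Rightarrow> complex) \<Rightarrow> complex" where
  "vertical_line_integral \<alpha> h = (LINT t|lborel. h (Complex \<alpha> t) * \<i>)"

definition vertical_line_abs_integrable :: "real \<Rightarrow> (complex \<Rightarrow> complex) \<Rightarrow> bool" where
  "vertical_line_abs_integrable \<alpha> h \<longleftrightarrow> integrable lborel (\<lambda>t. h (Complex \<alpha> t))"

definition inverse_laplace :: "real \<Rightarrow> (complex \<Rightarrow> complex) \<Rightarrow> real \<Rightarrow> complex" where
  "inverse_laplace \<alpha> F x =
     1 / (2 * of_real pi * \<i>) * vertical_line_integral \<alpha> (\<lambda>s. exp (s * of_real x) * F s)"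

end

theory Submission
  imports Defs "HOL-Probability.Characteristic_Functions"
begin

text \<open>
  Along \<open>Re u = \<alpha>\<close> the transform is the Fourier transform of
  \<open>g x = M_integrand \<rho> m f \<alpha> v \<omega> x\<close>, extended by zero to the left half-line, so the theorem is
  Fourier inversion for \<open>g\<close> at the continuity point \<open>x / \<omega>\<close>. Inversion is shown by Gaussian
  summation: damping the inversion integral by \<open>exp (- t\<^sup>2 / (2 k\<^sup>2))\<close> turns it, by Fubini, into an
  average of \<open>g\<close> against a Gaussian of width \<open>1 / k\<close>.
\<close>

section \<open>Gaussian integrals and the damped inversion formula\<close>

lemma gaussian_fourier_integral:
  fixes k s :: real
  assumes k: "k > 0"
  shows "(LINT t|lborel. iexp (s * t) * of_real (exp (- (t / k)\<^sup>2 / 2)))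
    = of_real (sqrt (2 * pi) * k * exp (- (k * s)\<^sup>2 / 2))"
proof -
  \<comment> \<open>Substituting \<open>t = k * z\<close> normalises the Gaussian. What remains is,
    up to the factor \<open>sqrt (2 * pi)\<close>, the characteristic function of the standard
    normal law at \<open>k * s\<close>.\<close>
  have "(LINT t|lborel. iexp (s * t) * of_real (exp (- (t / k)\<^sup>2 / 2)))
      = k *\<^sub>R (LINT z|lborel. iexp (s * (k * z)) * complex_of_real (exp (- z\<^sup>2 / 2)))"
    using lborel_integral_real_affine[of k "\<lambda>t. iexp (s * t) * complex_of_real (exp (- (t / k)\<^sup>2 / 2))" 0] k
    by simp
  also have "(LINT z|lborel. iexp (s * (k * z)) * complex_of_real (exp (- z\<^sup>2 / 2)))
      = (LINT z|lborel. sqrt (2 * pi) *\<^sub>R (std_normal_density z *\<^sub>R iexp ((k * s) * z)))"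
    by (intro Bochner_Integration.integral_cong)
      (auto simp: std_normal_density_def scaleR_conv_of_real mult_ac)
  also have "\<dots> = sqrt (2 * pi) *\<^sub>R char std_normal_distribution (k * s)"
    unfolding char_def by (subst integral_density) (auto simp flip: scaleR_scaleR)
  also have "\<dots> = of_real (sqrt (2 * pi) * exp (- (k * s)\<^sup>2 / 2))"
    by (simp add: char_std_normal_distribution scaleR_conv_of_real)
  finally show ?thesis
    by (simp add: scaleR_conv_of_real)
qed

lemma integrable_gaussian:
  fixes k :: real
  assumes "k > 0"
  shows "integrable lborel (\<lambda>t. exp (- (t / k)\<^sup>2 / 2))"
proof -
  have "integrable lborel (\<lambda>t. sqrt (2 * pi) * k * normal_density 0 k t)"
    using assms by (intro integrable_mult_right integrable_normal_density)
  then show ?thesis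
    using assms by (simp add: normal_density_def power_divide real_sqrt_mult mult.commute[of 2 "k\<^sup>2"])
qed

text \<open>In this form the density of width \<open>1 / k\<close> can be compared directly with the
  Fourier integral of the damping factor, which is \<open>2 * pi\<close> times as large.\<close>

lemma normal_density_inverse:
  fixes k :: real
  assumes k: "k > 0"
  shows "normal_density y (1 / k) x = k / sqrt (2 * pi) * exp (- (k * (x - y))\<^sup>2 / 2)"
proof -
  have "sqrt (2 * pi * (1 / k)\<^sup>2) = sqrt (2 * pi) / k"
    using k by (simp add: real_sqrt_mult real_sqrt_divide power_divide)
  moreover have "- (x - y)\<^sup>2 / (2 * (1 / k)\<^sup>2) = - (k * (x - y))\<^sup>2 / 2"
    using k by (simp add: field_simps power2_eq_square)
  ultimately show ?thesis
    unfolding normal_density_def by (simp only: divide_divide_eq_right mult_1_left)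
qed

lemma gaussian_damped_inversion:
  fixes g :: "real \<Rightarrow> complex" and k y :: real
  assumes g: "integrable lborel g" and k: "k > 0"
  shows "(LINT t|lborel. (iexp (t * y) * (LINT x|lborel. iexp (- t * x) * g x)) *
            of_real (exp (- (t / k)\<^sup>2 / 2)))
    = 2 * pi * (LINT x|lborel. normal_density y (1 / k) x *\<^sub>R g x)"
proof -
  have [measurable]: "g \<in> borel_measurable borel"
    using borel_measurable_integrable[OF g] by simp
  define G where "G t = complex_of_real (exp (- (t / k)\<^sup>2 / 2))" for t
  have [measurable]: "G \<in> borel_measurable borel"
    unfolding G_def by measurable
  define F where "F = (\<lambda>(x, t). iexp (t * (y - x)) * G t * g x)"
  have F_meas [measurable]: "F \<in> borel_measurable (lborel \<Otimes>\<^sub>M lborel)"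
    unfolding F_def by measurable
  have G_int: "integrable lborel G"
    unfolding G_def using integrable_of_real[OF integrable_gaussian[OF k]] by simp
  \<comment> \<open>The oscillating factor has modulus one, so the modulus of \<open>F\<close>
    separates into two integrable functions of one variable each.\<close>
  have normF: "norm (F (x, t)) = norm (G t) * norm (g x)" for x t
    by (simp add: F_def norm_mult)
  have F_int: "integrable (lborel \<Otimes>\<^sub>M lborel) F"
  proof (rule lborel_pair.Fubini_integrable)
    show "integrable lborel (\<lambda>x. LINT t|lborel. norm (F (x, t)))"
      unfolding normF using g G_int by simp
    show "AE x in lborel. integrable lborel (\<lambda>t. F (x, t))"
    proof (rule AE_I2)
      fix x
      have "integrable lborel (\<lambda>t. norm (G t) * norm (g x))"
        using G_int by simp
      then show "integrable lborel (\<lambda>t. F (x, t))"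
        by (rule Bochner_Integration.integrable_bound) (auto simp: normF)
    qed
  qed measurable
  have shift: "iexp (t * y) * iexp (- t * x) = iexp (t * (y - x))" for t x
    by (simp add: exp_add[symmetric] algebra_simps)
  have "(LINT t|lborel. (iexp (t * y) * (LINT x|lborel. iexp (- t * x) * g x)) * G t)
      = (LINT t|lborel. LINT x|lborel. F (x, t))"
  proof (rule Bochner_Integration.integral_cong)
    fix t
    have "F (x, t) = (iexp (t * y) * G t) * (iexp (- t * x) * g x)" for x
      unfolding F_def using shift[of t x] by (simp add: mult_ac)
    then show "(iexp (t * y) * (LINT x|lborel. iexp (- t * x) * g x)) * G t = (LINT x|lborel. F (x, t))"
      by (simp del: of_real_mult of_real_minus)
  qed simp
  also have "\<dots> = (LINT x|lborel. LINT t|lborel. F (x, t))"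
    using lborel_pair.Fubini_integral[of "\<lambda>x t. F (x, t)"] F_int by simp
  also have "\<dots> = (LINT x|lborel. (2 * pi) *\<^sub>R (normal_density y (1 / k) x *\<^sub>R g x))"
  proof (rule Bochner_Integration.integral_cong)
    fix x
    have "(LINT t|lborel. F (x, t)) = (LINT t|lborel. iexp ((y - x) * t) * G t) * g x"
      unfolding F_def prod.case mult.commute[of "y - x"] by (rule integral_mult_left_zero)
    also have "\<dots> = of_real (sqrt (2 * pi) * k * exp (- (k * (y - x))\<^sup>2 / 2)) * g x"
      unfolding G_def gaussian_fourier_integral[OF k] ..
    also have "sqrt (2 * pi) * k * exp (- (k * (y - x))\<^sup>2 / 2) = 2 * pi * normal_density y (1 / k) x"
    proof -
      have "2 * pi * (k / sqrt (2 * pi)) = 2 * pi / sqrt (2 * pi) * k"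
        by simp
      also have "2 * pi / sqrt (2 * pi) = sqrt (2 * pi)"
        by (rule real_div_sqrt) simp
      finally show ?thesis
        unfolding normal_density_inverse[OF k] power_mult_distrib power2_commute[of y x]
        by (simp only: mult.assoc[symmetric])
    qed
    finally show "(LINT t|lborel. F (x, t)) = (2 * pi) *\<^sub>R (normal_density y (1 / k) x *\<^sub>R g x)"
      by (simp add: scaleR_conv_of_real)
  qed simp
  finally show ?thesis
    by (simp add: G_def scaleR_conv_of_real)
qed

section \<open>The Gaussian as an approximate identity, and Fourier inversion\<close>

lemma normal_density_le_off_mean:
  fixes k d x y :: real
  assumes k: "k > 0" and d: "d > 0" and x: "d \<le> \<bar>x - y\<bar>"
  shows "normal_density y (1 / k) x \<le> 2 / (k * d\<^sup>2)"
proof -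
  define q where "q = (k * d)\<^sup>2 / 2"
  have q: "q > 0" using k d by (simp add: q_def)
  have "d\<^sup>2 \<le> (x - y)\<^sup>2"
    using x d by (simp add: abs_le_square_iff[symmetric])
  then have "q \<le> (k * (x - y))\<^sup>2 / 2"
    by (simp add: q_def power_mult_distrib mult_left_mono)
  then have e1: "exp (- (k * (x - y))\<^sup>2 / 2) \<le> exp (- q)"
    by simp
  \<comment> \<open>The crude bound \<open>exp (- q) \<le> 1 / q\<close> suffices:
    \<open>1 / q\<close> is of order \<open>1 / k\<^sup>2\<close>, which beats the prefactor of
    order \<open>k\<close> and leaves decay of order \<open>1 / k\<close>, uniformly in
    \<open>x\<close> off the mean.\<close>
  have "q \<le> exp q"
    using exp_ge_add_one_self[of q] by linarith
  then have e2: "exp (- q) \<le> 1 / q"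
    using q by (simp add: exp_minus field_simps)
  have "1 \<le> sqrt (2 * pi)"
    using pi_gt3 by simp
  then have "k / sqrt (2 * pi) \<le> k"
    using k by (simp add: field_simps)
  then have "normal_density y (1 / k) x \<le> k * (1 / q)"
    unfolding normal_density_inverse[OF k] using order_trans[OF e1 e2] k by (intro mult_mono) auto
  also have "\<dots> = 2 / (k * d\<^sup>2)"
    using k d by (simp add: q_def field_simps power2_eq_square)
  finally show ?thesis .
qed

text \<open>As \<open>g\<close> may be unbounded away from \<open>y\<close>, dominated convergence
  does not apply to it directly after rescaling. So \<open>g\<close> is split: near \<open>y\<close>
  it is bounded by continuity and dominated convergence works; far from \<open>y\<close> the density
  is uniformly small and multiplies an integrable function.\<close>

lemma tendsto_normal_density_average:
  fixes g :: "real \<Rightarrow> complex" and y :: real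
  assumes g: "integrable lborel g" and cont: "isCont g y"
  shows "(\<lambda>n. LINT x|lborel. normal_density y (1 / real (Suc n)) x *\<^sub>R g x) \<longlonglongrightarrow> g y"
proof -
  have [measurable]: "g \<in> borel_measurable borel"
    using borel_measurable_integrable[OF g] by simp
  \<comment> \<open>The tolerance 1 serves only to bound \<open>g\<close> near \<open>y\<close>; the
    limit itself comes later from \<open>isCont g y\<close>.\<close>
  obtain d where d: "d > 0" and near: "\<And>x. \<bar>x - y\<bar> < d \<Longrightarrow> norm (g x - g y) < 1"
    using cont unfolding continuous_at_eps_delta dist_norm real_norm_def
    by (metis zero_less_one)
  define A where "A = {x. \<bar>x - y\<bar> < d}"
  have [measurable]: "A \<in> sets borel"
    unfolding A_def by measurable
  define g1 where "g1 x = indicator A x *\<^sub>R g x" for x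
  define g2 where "g2 x = indicator (- A) x *\<^sub>R g x" for x
  have [measurable]: "g1 \<in> borel_measurable borel" "g2 \<in> borel_measurable borel"
    unfolding g1_def g2_def by measurable
  \<comment> \<open>\<open>Suc n\<close> keeps the width positive and finite already at
    \<open>n = 0\<close>.\<close>
  define N where "N n = normal_density y (1 / real (Suc n))" for n
  have g1_bound: "norm (g1 x) \<le> 1 + norm (g y)" for x
    using near[of x] norm_triangle_ineq2[of "g x" "g y"] by (auto simp: g1_def A_def indicator_def)
  have N_int: "integrable lborel (N n)" for n
    unfolding N_def by (rule integrable_normal_density) simp
  have [measurable]: "N n \<in> borel_measurable borel" for n
    unfolding N_def by measurable
  have g1_int: "integrable lborel (\<lambda>x. N n x *\<^sub>R g1 x)" for n
  proof (rule Bochner_Integration.integrable_bound)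
    show "integrable lborel (\<lambda>x. N n x * (1 + norm (g y)))"
      using N_int by simp
    show "AE x in lborel. norm (N n x *\<^sub>R g1 x) \<le> norm (N n x * (1 + norm (g y)))"
      using g1_bound by (auto simp: abs_mult intro!: mult_left_mono AE_I2)
  qed measurable
  have g2_bound: "norm (N n x *\<^sub>R g2 x) \<le> 2 / (real (Suc n) * d\<^sup>2) * norm (g x)" for n x
  proof (cases "x \<in> A")
    case True
    then show ?thesis by (simp add: g2_def)
  next
    case False
    then have "N n x \<le> 2 / (real (Suc n) * d\<^sup>2)"
      unfolding N_def A_def by (intro normal_density_le_off_mean d) auto
    with False mult_right_mono[OF this norm_ge_zero[of "g x"]] show ?thesis
      by (simp add: g2_def N_def del: of_nat_Suc)
  qed
  have g2_int: "integrable lborel (\<lambda>x. N n x *\<^sub>R g2 x)" for n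
  proof (rule Bochner_Integration.integrable_bound)
    show "integrable lborel (\<lambda>x. 2 / (real (Suc n) * d\<^sup>2) * norm (g x))"
      using g by simp
    show "AE x in lborel. norm (N n x *\<^sub>R g2 x) \<le> norm (2 / (real (Suc n) * d\<^sup>2) * norm (g x))"
      using order_trans[OF g2_bound abs_ge_self] by simp
  qed measurable
  have "(\<lambda>n. LINT x|lborel. N n x *\<^sub>R g1 x) \<longlonglongrightarrow> g y"
  proof -
    \<comment> \<open>Rescaling around \<open>y\<close> moves the dependence on \<open>n\<close>
      from the density into the argument of \<open>g1\<close>, so one integrable bound serves all
      \<open>n\<close>.\<close>
    have "(LINT x|lborel. N n x *\<^sub>R g1 x)
        = (LINT z|lborel. std_normal_density z *\<^sub>R g1 (y + 1 / real (Suc n) * z))" for n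
    proof -
      define c where "c = 1 / real (Suc n)"
      have c: "c > 0" by (simp add: c_def)
      have "c * N n (y + c * z) = std_normal_density z" for z
        unfolding N_def c_def[symmetric] using c
        by (simp add: normal_density_def power_mult_distrib real_sqrt_mult)
      then show ?thesis
        unfolding c_def[symmetric]
        using lborel_integral_real_affine[of c "\<lambda>x. N n x *\<^sub>R g1 x" y] c
        by (simp flip: integral_scaleR_right)
    qed
    moreover have "(\<lambda>n. LINT z|lborel. std_normal_density z *\<^sub>R g1 (y + 1 / real (Suc n) * z))
        \<longlonglongrightarrow> (LINT z|lborel. std_normal_density z *\<^sub>R g y)"
    proof (rule integral_dominated_convergence)
      show "integrable lborel (\<lambda>z. std_normal_density z * (1 + norm (g y)))"
        by simp
      show "AE z in lborel. norm (std_normal_density z *\<^sub>R g1 (y + 1 / real (Suc n) * z))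
          \<le> std_normal_density z * (1 + norm (g y))" for n
        using g1_bound by (auto intro!: mult_left_mono AE_I2)
      show "AE z in lborel. (\<lambda>n. std_normal_density z *\<^sub>R g1 (y + 1 / real (Suc n) * z))
          \<longlonglongrightarrow> std_normal_density z *\<^sub>R g y"
      proof (rule AE_I2)
        fix z :: real
        have lim: "(\<lambda>n. y + 1 / real (Suc n) * z) \<longlonglongrightarrow> y"
          using tendsto_add[OF tendsto_const tendsto_mult_left_zero[OF LIMSEQ_inverse_real_of_nat]]
          by (auto simp: inverse_eq_divide)
        \<comment> \<open>For fixed \<open>z\<close> the sample points eventually lie in
          \<open>A\<close>, where the cutoff in \<open>g1\<close> is invisible and continuity of
          \<open>g\<close> applies.\<close>
        have "eventually (\<lambda>n. \<bar>y + 1 / real (Suc n) * z - y\<bar> < d) sequentially"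
          using tendstoD[OF lim d] by (simp add: dist_norm)
        then have "eventually (\<lambda>n. g (y + 1 / real (Suc n) * z) = g1 (y + 1 / real (Suc n) * z)) sequentially"
          by eventually_elim (simp add: g1_def A_def)
        moreover have "(\<lambda>n. g (y + 1 / real (Suc n) * z)) \<longlonglongrightarrow> g y"
          using isCont_tendsto_compose[OF cont lim] .
        ultimately have "(\<lambda>n. g1 (y + 1 / real (Suc n) * z)) \<longlonglongrightarrow> g y"
          by (rule Lim_transform_eventually[rotated])
        then show "(\<lambda>n. std_normal_density z *\<^sub>R g1 (y + 1 / real (Suc n) * z))
            \<longlonglongrightarrow> std_normal_density z *\<^sub>R g y"
          by (intro tendsto_intros)
      qed
    qed measurable
    moreover have "(LINT z|lborel. std_normal_density z *\<^sub>R g y) = g y"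
      by simp
    ultimately show ?thesis by simp
  qed
  moreover have "(\<lambda>n. LINT x|lborel. N n x *\<^sub>R g2 x) \<longlonglongrightarrow> 0"
  proof (rule Lim_null_comparison)
    show "\<forall>\<^sub>F n in sequentially. norm (LINT x|lborel. N n x *\<^sub>R g2 x)
        \<le> inverse (real (Suc n)) * (2 / d\<^sup>2 * (LINT x|lborel. norm (g x)))"
    proof (rule always_eventually, rule allI)
      fix n
      have "norm (LINT x|lborel. N n x *\<^sub>R g2 x)
          \<le> (LINT x|lborel. 2 / (real (Suc n) * d\<^sup>2) * norm (g x))"
        by (rule Bochner_Integration.integral_norm_bound_integral[OF g2_int _ g2_bound])
          (use g in simp)
      then show "norm (LINT x|lborel. N n x *\<^sub>R g2 x)
          \<le> inverse (real (Suc n)) * (2 / d\<^sup>2 * (LINT x|lborel. norm (g x)))"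
        by (simp add: field_simps)
    qed
    show "(\<lambda>n. inverse (real (Suc n)) * (2 / d\<^sup>2 * (LINT x|lborel. norm (g x)))) \<longlonglongrightarrow> 0"
      by (rule tendsto_mult_left_zero[OF LIMSEQ_inverse_real_of_nat])
  qed
  ultimately have "(\<lambda>n. (LINT x|lborel. N n x *\<^sub>R g1 x) + (LINT x|lborel. N n x *\<^sub>R g2 x)) \<longlonglongrightarrow> g y + 0"
    by (rule tendsto_add)
  moreover have "(LINT x|lborel. N n x *\<^sub>R g1 x) + (LINT x|lborel. N n x *\<^sub>R g2 x)
      = (LINT x|lborel. N n x *\<^sub>R g x)" for n
    unfolding Bochner_Integration.integral_add[OF g1_int g2_int, symmetric]
    by (rule Bochner_Integration.integral_cong) (auto simp: g1_def g2_def indicator_def)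
  ultimately show ?thesis
    by (simp add: N_def)
qed

text \<open>The damped integrals have two limits, which must coincide. Since the transform is
  integrable, removing the damping is dominated convergence and gives the inversion integral; since
  \<open>g\<close> is integrable and continuous at \<open>y\<close>, the Gaussian averages give
  \<open>2 * pi * g y\<close>.\<close>

theorem Fourier_inversion_isCont:
  fixes g :: "real \<Rightarrow> complex" and y :: real
  assumes g: "integrable lborel g" and cont: "isCont g y"
    and hat: "integrable lborel (\<lambda>t. LINT x|lborel. iexp (- t * x) * g x)"
  shows "(LINT t|lborel. iexp (t * y) * (LINT x|lborel. iexp (- t * x) * g x)) = 2 * pi * g y"
proof -
  define h where "h t = iexp (t * y) * (LINT x|lborel. iexp (- t * x) * g x)" for t
  have hat_meas: "(\<lambda>t. LINT x|lborel. iexp (- t * x) * g x) \<in> borel_measurable borel"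
    using borel_measurable_integrable[OF hat] by simp
  have h_meas [measurable]: "h \<in> borel_measurable borel"
    unfolding h_def by (intro borel_measurable_times hat_meas) measurable
  have h_int: "integrable lborel h"
    by (rule Bochner_Integration.integrable_bound[OF hat]) (auto simp: h_def norm_mult)
  have "(\<lambda>n. LINT t|lborel. h t * of_real (exp (- (t / real (Suc n))\<^sup>2 / 2))) \<longlonglongrightarrow> (LINT t|lborel. h t)"
  proof (rule integral_dominated_convergence)
    show "integrable lborel (\<lambda>t. norm (h t))"
      using h_int by simp
    show "AE t in lborel. norm (h t * of_real (exp (- (t / real (Suc n))\<^sup>2 / 2))) \<le> norm (h t)" for n
      by (auto simp: norm_mult intro!: mult_left_le)
    show "AE t in lborel. (\<lambda>n. h t * of_real (exp (- (t / real (Suc n))\<^sup>2 / 2))) \<longlonglongrightarrow> h t"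
    proof (rule AE_I2)
      fix t
      have "(\<lambda>n. t / real (Suc n)) \<longlonglongrightarrow> 0"
        using tendsto_mult_right_zero[OF LIMSEQ_inverse_real_of_nat, of t]
        by (simp add: divide_inverse)
      then have "(\<lambda>n. h t * of_real (exp (- (t / real (Suc n))\<^sup>2 / 2))) \<longlonglongrightarrow> h t * of_real (exp (- 0\<^sup>2 / 2))"
        by (intro tendsto_intros) auto
      then show "(\<lambda>n. h t * of_real (exp (- (t / real (Suc n))\<^sup>2 / 2))) \<longlonglongrightarrow> h t"
        by simp
    qed
  qed measurable
  moreover have "(\<lambda>n. LINT t|lborel. h t * of_real (exp (- (t / real (Suc n))\<^sup>2 / 2))) \<longlonglongrightarrow> 2 * pi * g y"
    unfolding h_def gaussian_damped_inversion[OF g of_nat_0_less_iff[THEN iffD2, OF zero_less_Suc]]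
    by (intro tendsto_intros tendsto_normal_density_average g cont)
  ultimately show ?thesis
    unfolding h_def by (rule LIMSEQ_unique)
qed

section \<open>Application to the transform along the vertical line\<close>

theorem theorem3p5:
  fixes \<rho> v :: complex and m :: nat and \<omega> \<alpha> :: real and f :: "real \<Rightarrow> complex"
  assumes "Re \<rho> > 0" and "m \<ge> 1" and "\<omega> > 0" and "\<alpha> > 0"
    and "continuous_on {0<..} f \<or> piecewise_continuous_pos f"
    and "\<And>u. Re u = \<alpha> \<Longrightarrow> M_abs_convergent \<rho> m f u v \<omega>"
    and "vertical_line_abs_integrable \<alpha> (\<lambda>u. M_transform \<rho> m f u v \<omega>)"
  shows "\<forall>x>0. isCont f x \<longrightarrow>
           f x = of_real (x ^ m / \<omega> ^ m + \<omega> ^ m) powr \<rho> * exp (of_real \<omega> * v / of_real x)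
                 * inverse_laplace \<alpha> (\<lambda>u. M_transform \<rho> m f u v \<omega>) (x / \<omega>)"
proof (intro allI impI)
  fix x :: real
  assume x: "x > 0" and fx: "isCont f x"
  define y where "y = x / \<omega>"
  have y: "y > 0" and xy: "\<omega> * y = x"
    using x \<open>\<omega> > 0\<close> by (simp_all add: y_def)
  \<comment> \<open>The choice \<open>u = \<alpha>\<close> is the point of the line with imaginary
    part zero; the other points differ from it only by an oscillating factor of modulus one.\<close>
  define g where "g s = indicator {0<..} s *\<^sub>R M_integrand \<rho> m f (of_real \<alpha>) v \<omega> s" for s :: real
  have g: "integrable lborel g"
    using assms(6)[of "of_real \<alpha>"] by (simp add: M_abs_convergent_def set_integrable_def g_def [abs_def])
  have "isCont (\<lambda>s. M_integrand \<rho> m f (of_real \<alpha>) v \<omega> s) y"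
  proof -
    have pos: "y ^ m + \<omega> ^ m > 0"
      using y \<open>\<omega> > 0\<close> by (simp add: add_pos_pos)
    then have nz: "complex_of_real (y ^ m + \<omega> ^ m) \<noteq> 0"
      by (simp only: of_real_eq_0_iff)
    have 1: "isCont (\<lambda>s. f (\<omega> * s)) y"
      by (rule isCont_o2[where f = "\<lambda>s. \<omega> * s" and g = f]) (simp_all add: fx xy)
    \<comment> \<open>The principal power is continuous in its base off the nonpositive real axis,
      and the base at \<open>y\<close> is a positive real.\<close>
    have "complex_of_real (y ^ m + \<omega> ^ m) \<notin> \<real>\<^sub>\<le>\<^sub>0"
      using pos by (simp only: nonpos_Reals_of_real_iff not_le)
    moreover have "isCont (\<lambda>s. complex_of_real (s ^ m + \<omega> ^ m)) y"
      by (intro continuous_intros)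
    ultimately have 2: "isCont (\<lambda>s. complex_of_real (s ^ m + \<omega> ^ m) powr \<rho>) y"
      unfolding isCont_def by (rule tendsto_powr_complex[OF _ _ tendsto_const])
    have 3: "isCont (\<lambda>s. exp (- of_real \<alpha> * of_real s - v / complex_of_real s)) y"
      using y by (intro continuous_intros) simp
    have "complex_of_real (y ^ m + \<omega> ^ m) powr \<rho> \<noteq> 0"
      using nz by (simp only: powr_eq_0_iff not_False_eq_True)
    then show ?thesis
      unfolding M_integrand_def by (intro isCont_mult isCont_divide 1 2 3)
  qed
  \<comment> \<open>The jump that the extension by zero may cause at 0 is harmless: \<open>y\<close>
    has a neighbourhood inside the open half-line.\<close>
  moreover have "\<forall>\<^sub>F s in nhds y. g s = M_integrand \<rho> m f (of_real \<alpha>) v \<omega> s"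
    using eventually_nhds_in_open[of "{0<..}" y] y by (auto elim!: eventually_mono simp: g_def)
  ultimately have cont: "isCont g y"
    by (simp add: isCont_cong)
  have transform: "M_transform \<rho> m f (Complex \<alpha> t) v \<omega> = (LINT s|lborel. iexp (- t * s) * g s)" for t
    unfolding M_transform_def set_lebesgue_integral_def
  proof (rule Bochner_Integration.integral_cong)
    fix s :: real
    have "- Complex \<alpha> t * of_real s - v / of_real s
        = \<i> * of_real (- t * s) + (- of_real \<alpha> * of_real s - v / of_real s)"
      by (simp add: Complex_eq algebra_simps)
    then have "exp (- Complex \<alpha> t * of_real s - v / of_real s)
        = iexp (- t * s) * exp (- of_real \<alpha> * of_real s - v / of_real s)"
      by (simp only: exp_add)
    then show "indicator {0<..} s *\<^sub>R M_integrand \<rho> m f (Complex \<alpha> t) v \<omega> s = iexp (- t * s) * g s"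
      unfolding g_def M_integrand_def by (simp only: mult_scaleR_right times_divide_eq_right mult.assoc times_divide_eq_left)
  qed simp
  have hat: "integrable lborel (\<lambda>t. LINT s|lborel. iexp (- t * s) * g s)"
    using assms(7) unfolding vertical_line_abs_integrable_def transform .
  \<comment> \<open>The constant \<open>\<i>\<close> comes from \<open>ds = \<i> dt\<close>, and
    \<open>exp (of_real (\<alpha> * y))\<close> from the real part of \<open>s\<close> on the line.
    Inversion then yields \<open>2 * pi * g y\<close>, and the prefactor
    \<open>1 / (2 * of_real pi * \<i>)\<close> cancels both \<open>2 * pi\<close> and
    \<open>\<i>\<close>.\<close>
  have "inverse_laplace \<alpha> (\<lambda>u. M_transform \<rho> m f u v \<omega>) y
      = 1 / (2 * of_real pi * \<i>) *
        (LINT t|lborel. (\<i> * exp (of_real (\<alpha> * y))) * (iexp (t * y) * (LINT s|lborel. iexp (- t * s) * g s)))"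
  proof -
    have "exp (Complex \<alpha> t * of_real y) = exp (of_real (\<alpha> * y)) * iexp (t * y)" for t
      by (simp add: Complex_eq exp_add[symmetric] algebra_simps)
    then show ?thesis
      unfolding inverse_laplace_def vertical_line_integral_def transform
      by (simp only: mult_ac)
  qed
  also have "\<dots> = exp (of_real (\<alpha> * y)) * g y"
    unfolding integral_mult_right_zero Fourier_inversion_isCont[OF g cont hat]
    by simp
  also have "g y = exp (- of_real (\<alpha> * y) - v / of_real y) / (of_real (y ^ m + \<omega> ^ m) powr \<rho>) * f x"
    using y by (simp add: g_def M_integrand_def xy)
  \<comment> \<open>The weight \<open>exp (- \<alpha> * y)\<close> inside \<open>g y\<close> cancels
    the factor from the line, so the value no longer depends on \<open>\<alpha>\<close>.\<close>
  also have "exp (of_real (\<alpha> * y)) * \<dots> = exp (- v / of_real y) / (of_real (y ^ m + \<omega> ^ m) powr \<rho>) * f x"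
  proof -
    have "exp (of_real (\<alpha> * y)) * exp (- of_real (\<alpha> * y) - v / of_real y) = exp (- v / of_real y)"
      by (simp add: exp_add[symmetric])
    then show ?thesis
      by (metis times_divide_eq_right mult.assoc)
  qed
  finally have inv: "inverse_laplace \<alpha> (\<lambda>u. M_transform \<rho> m f u v \<omega>) y
      = exp (- v / of_real y) / (of_real (y ^ m + \<omega> ^ m) powr \<rho>) * f x" .
  have "y ^ m + \<omega> ^ m > 0"
    using y \<open>\<omega> > 0\<close> by (simp add: add_pos_pos)
  then have nz: "complex_of_real (y ^ m + \<omega> ^ m) powr \<rho> \<noteq> 0"
    by (simp del: of_real_add of_real_power)
  have e1: "x ^ m / \<omega> ^ m = y ^ m"
    by (simp add: y_def power_divide)
  have e2: "of_real \<omega> * v / of_real x = v / of_real y"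
    by (simp add: y_def)
  show "f x = of_real (x ^ m / \<omega> ^ m + \<omega> ^ m) powr \<rho> * exp (of_real \<omega> * v / of_real x)
      * inverse_laplace \<alpha> (\<lambda>u. M_transform \<rho> m f u v \<omega>) (x / \<omega>)"
    \<comment> \<open>In terms of \<open>y\<close>, the two factors in front are the reciprocals of
      those multiplying \<open>f x\<close> in \<open>inv\<close>; cancelling the power needs
      \<open>nz\<close>.\<close>
    unfolding e1 e2 y_def[symmetric] inv using nz by (simp add: exp_minus)
qed

end
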